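(* Let $(M,d)$ be a nonempty hyperconvex metric space, let $G$ be a group, and let $\{T_a : a\in G\}$ be a uniformly $L$-Lipschitzian action of $G$ on $M$, where $0<L<\sqrt{2}$. Suppose that all orbits $O(x)=\{T_a x : a\in G\}$, $x\in M$, are bounded. Then the set of common fixed points $\operatorname{Fix} G=\{x\in M : T_a x=x \text{ for all } a\in G\}$ is nonempty.
   Context: A metric space $(M,d)$ is called hyperconvex if $\bigcap_{\alpha\in\Gamma}B(x_\alpha,r_\alpha)\neq\emptyset$ for any collection of closed balls $\{B(x_\alpha,r_\alpha)\}_{\alpha\in\Gamma}$ in $M$ (with $r_\alpha\ge 0$) such that $d(x_\alpha,x_\beta)\le r_\alpha+r_\beta$ for all $\alpha,\beta\in\Gamma$; here $B(x,r)=\{y\in M: d(x,y)\le r\}$. A group $G$ with identity $e$ acts on $M$ by maps $T_a:M\to M$, $a\in G$, if $T_a(T_b x)=T_{ab}x$ and $T_e x=x$ for all $a,b\in G$, $x\in M$. The action is uniformly $L$-Lipschitzian if $d(T_a x,T_a y)\le L\,d(x,y)$ for all $a\in G$ and $x,y\in M$ (the same constant $L$ for all $a$). *)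

theory Defs
  imports "HOL-Analysis.Abstract_Metric_Spaces" "HOL-Algebra.Group_Action"
begin

(* A family of balls is represented by its set C of (centre, radius) pairs, since neither
   the hypothesis nor the conclusion depends on the indexing.  Intersecting with M makes
   the empty family have intersection M rather than UNIV. *)
definition (in Metric_space) hyperconvex :: bool where
  "hyperconvex \<longleftrightarrow>
     (\<forall>C \<subseteq> M \<times> {0..}.
        (\<forall>(x, r) \<in> C. \<forall>(y, s) \<in> C. d x y \<le> r + s) \<longrightarrow>
        M \<inter> (\<Inter>(x, r) \<in> C. mcball x r) \<noteq> {})"

(* Unlike the library locale group_action, this does not require the maps T a to be
   extensional (undefined outside M). *)
definition acts_on :: "('g, 'b) monoid_scheme \<Rightarrow> 'a set \<Rightarrow> ('g \<Rightarrow> 'a \<Rightarrow> 'a) \<Rightarrow> bool" where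
  "acts_on G M T \<longleftrightarrow>
     (\<forall>a \<in> carrier G. T a \<in> M \<rightarrow> M) \<and>
     (\<forall>a \<in> carrier G. \<forall>b \<in> carrier G. \<forall>x \<in> M. T a (T b x) = T (a \<otimes>\<^bsub>G\<^esub> b) x) \<and>
     (\<forall>x \<in> M. T \<one>\<^bsub>G\<^esub> x = x)"

definition (in Metric_space) uniformly_lipschitzian ::
    "('g, 'b) monoid_scheme \<Rightarrow> ('g \<Rightarrow> 'a \<Rightarrow> 'a) \<Rightarrow> real \<Rightarrow> bool" where
  "uniformly_lipschitzian G T L \<longleftrightarrow>
     (\<forall>a \<in> carrier G. \<forall>x \<in> M. \<forall>y \<in> M. d (T a x) (T a y) \<le> L * d x y)"

definition common_fixed_points ::
    "('g, 'b) monoid_scheme \<Rightarrow> 'a set \<Rightarrow> ('g \<Rightarrow> 'a \<Rightarrow> 'a) \<Rightarrow> 'a set" where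
  "common_fixed_points G M T = {x \<in> M. \<forall>a \<in> carrier G. T a x = x}"

end

(* If the orbit O(x) has diameter at most D, hyperconvexity provides a point z that lies within
   D/2 of the whole orbit and also in every closed ball containing the orbit.  By equivariance
   O(x) is contained in each ball B(T_a z, L D/2), hence so is z; applying the action once more,
   O(z) has diameter at most (L^2/2) D.  As L^2/2 < 1, iterating gives a sequence with summable
   steps whose limit is fixed by the action. *)
theory Submission imports Defs begin

context Metric_space
begin

lemma hyperconvexE:
  assumes "hyperconvex"
    and "C \<subseteq> M \<times> {0..}"
    and "\<And>x r y s. (x, r) \<in> C \<Longrightarrow> (y, s) \<in> C \<Longrightarrow> d x y \<le> r + s"
  obtains z where "z \<in> M" and "\<And>x r. (x, r) \<in> C \<Longrightarrow> d x z \<le> r"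
proof -
  have "M \<inter> (\<Inter>(x, r) \<in> C. mcball x r) \<noteq> {}"
    using assms(1)[unfolded hyperconvex_def, rule_format, OF assms(2)] assms(3) by auto
  then obtain z where "z \<in> M" "z \<in> (\<Inter>(x, r) \<in> C. mcball x r)"
    by blast
  then show ?thesis
    by (intro that) auto
qed

text \<open>Balls of radius \<open>D / 2\<close> about the points of \<open>A\<close>, taken
  together with all closed balls containing \<open>A\<close>, satisfy the pairwise condition of
  hyperconvexity. For two balls of the first kind this is the diameter bound; in a mixed pair, the
  center of the small ball lies in the other ball; two balls of the second kind share a point
  \<open>p\<close> of \<open>A\<close>.\<close>

lemma hyperconvex_center:
  assumes hc: "hyperconvex" and "A \<subseteq> M" and "A \<noteq> {}"
    and diam: "\<And>x y. x \<in> A \<Longrightarrow> y \<in> A \<Longrightarrow> d x y \<le> D"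
  obtains z where "z \<in> M" and "\<And>x. x \<in> A \<Longrightarrow> d x z \<le> D / 2"
    and "\<And>c R. c \<in> M \<Longrightarrow> A \<subseteq> mcball c R \<Longrightarrow> d c z \<le> R"
proof -
  from \<open>A \<noteq> {}\<close> obtain p where p: "p \<in> A" by blast
  then have pM: "p \<in> M" using \<open>A \<subseteq> M\<close> by blast
  have D: "0 \<le> D" using diam[OF p p] nonneg[of p p] by linarith
  define C where "C = A \<times> {D / 2} \<union> {(c, R). c \<in> M \<and> A \<subseteq> mcball c R}"
  obtain z where z: "z \<in> M" "\<And>x r. (x, r) \<in> C \<Longrightarrow> d x z \<le> r"
  proof (rule hyperconvexE[OF hc, of C])
    \<comment> \<open>A ball containing \<open>A\<close> contains \<open>p\<close>, so its radius is
      at least \<open>d c p\<close>.\<close>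
    have "0 \<le> R" if "A \<subseteq> mcball c R" for c R
      using subsetD[OF that p] order_trans[OF nonneg[of c p]] by simp
    then show "C \<subseteq> M \<times> {0..}"
      unfolding C_def using D \<open>A \<subseteq> M\<close> by auto
  next
    fix x r y s assume "(x, r) \<in> C" "(y, s) \<in> C"
    then consider
        "x \<in> A" "r = D / 2" "y \<in> A" "s = D / 2"
      | "x \<in> A" "r = D / 2" "A \<subseteq> mcball y s"
      | "A \<subseteq> mcball x r" "y \<in> A" "s = D / 2"
      | "x \<in> M" "A \<subseteq> mcball x r" "y \<in> M" "A \<subseteq> mcball y s"
      unfolding C_def by blast
    then show "d x y \<le> r + s"
    proof cases
      case 1
      then show ?thesis using diam[of x y] by simp
    next
      case 2
      then have "d y x \<le> s" by auto
      then show ?thesis using 2 D commute[of x y] by simp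
    next
      case 3
      then have "d x y \<le> r" by auto
      then show ?thesis using 3 D by simp
    next
      case 4
      then have "d x p \<le> r" "d y p \<le> s" using p by auto
      then show ?thesis
        using triangle[of x p y] 4 pM commute[of y p] by linarith
    qed
  qed blast
  then show ?thesis
    by (intro that[of z]) (simp_all add: C_def del: le_divide_eq_numeral1)
qed

text \<open>Hyperconvexity takes the place of completeness: telescoping gives
  \<open>d (x m) (x n) \<le> r m - r n\<close> for \<open>m \<le> n\<close>, so the balls of radius
  \<open>r n\<close> about \<open>x n\<close> have a common point. It is the limit of
  \<open>x\<close> once \<open>r\<close> tends to 0.\<close>

lemma hyperconvex_telescoping_limit:
  assumes hc: "hyperconvex" and x: "\<And>n. x n \<in> M" and r: "\<And>n. 0 \<le> r n"
    and step: "\<And>n. d (x n) (x (Suc n)) \<le> r n - r (Suc n)"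
  obtains z where "z \<in> M" and "\<And>n. d (x n) z \<le> r n"
proof -
  have tele: "d (x m) (x (m + k)) \<le> r m - r (m + k)" for m k
  proof (induction k)
    case 0
    then show ?case using x by simp
  next
    case (Suc k)
    then show ?case
      using triangle[of "x m" "x (m + k)" "x (Suc (m + k))"] step[of "m + k"] x by simp
  qed
  have near: "d (x m) (x n) \<le> r m + r n" for m n
  proof (cases "m \<le> n")
    case True
    then show ?thesis using tele[of m "n - m"] r[of n] by simp
  next
    case False
    then show ?thesis using tele[of n "m - n"] r[of m] commute[of "x m" "x n"] by simp
  qed
  obtain z where "z \<in> M" "\<And>y s. (y, s) \<in> range (\<lambda>n. (x n, r n)) \<Longrightarrow> d y z \<le> s"
    using x r near by (elim hyperconvexE[OF hc, of "range (\<lambda>n. (x n, r n))", rotated 2]) auto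
  then show ?thesis
    by (intro that) auto
qed

text \<open>One round of the iteration. The halving comes from the radius \<open>D / 2\<close> of
  the center, and each of the two factors \<open>L\<close> from one use of
  \<open>Lip\<close>.\<close>

lemma orbit_contraction:
  assumes hc: "hyperconvex" and "group G" and act: "acts_on G M T"
    and lip: "uniformly_lipschitzian G T L" and "0 \<le> L" and x: "x \<in> M"
    and diam: "\<And>a b. a \<in> carrier G \<Longrightarrow> b \<in> carrier G \<Longrightarrow> d (T a x) (T b x) \<le> D"
  obtains z where "z \<in> M" and "d x z \<le> D / 2"
    and "\<And>a b. a \<in> carrier G \<Longrightarrow> b \<in> carrier G \<Longrightarrow> d (T a z) (T b z) \<le> L\<^sup>2 / 2 * D"
proof -
  interpret G: group G by fact
  have TM: "T a y \<in> M" if "a \<in> carrier G" "y \<in> M" for a y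
    using act that unfolding acts_on_def by auto
  have TT: "T a (T b y) = T (a \<otimes>\<^bsub>G\<^esub> b) y" if "a \<in> carrier G" "b \<in> carrier G" "y \<in> M" for a b y
    using act that unfolding acts_on_def by auto
  have T1: "T \<one>\<^bsub>G\<^esub> y = y" if "y \<in> M" for y
    using act that unfolding acts_on_def by auto
  \<comment> \<open>Two different group elements are compared by factoring \<open>b\<close> as
    \<open>a\<close> times \<open>inv a \<otimes> b\<close>, which leaves a Lipschitz estimate for
    \<open>T a\<close> alone.\<close>
  have Lip: "d (T a y) (T b w) \<le> L * d y (T (inv\<^bsub>G\<^esub> a \<otimes>\<^bsub>G\<^esub> b) w)"
    if "a \<in> carrier G" "b \<in> carrier G" "y \<in> M" "w \<in> M" for a b y w
  proof -
    have "T b w = T a (T (inv\<^bsub>G\<^esub> a \<otimes>\<^bsub>G\<^esub> b) w)"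
      using that by (simp add: TT flip: G.m_assoc)
    then show ?thesis
      using lip that TM unfolding uniformly_lipschitzian_def by simp
  qed
  define A where "A = (\<lambda>a. T a x) ` carrier G"
  obtain z where z: "z \<in> M" "\<And>y. y \<in> A \<Longrightarrow> d y z \<le> D / 2"
      "\<And>c R. c \<in> M \<Longrightarrow> A \<subseteq> mcball c R \<Longrightarrow> d c z \<le> R"
    by (rule hyperconvex_center[OF hc, of A D]) (auto simp: A_def x TM diam)
  have orbit_near: "d (T a z) (T b x) \<le> L * (D / 2)" if "a \<in> carrier G" "b \<in> carrier G" for a b
  proof -
    have "d z (T (inv\<^bsub>G\<^esub> a \<otimes>\<^bsub>G\<^esub> b) x) \<le> D / 2"
      using z(2)[of "T (inv\<^bsub>G\<^esub> a \<otimes>\<^bsub>G\<^esub> b) x"] that commute[of z]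
      by (auto simp: A_def)
    then show ?thesis
      using order_trans[OF Lip[OF that z(1) x] mult_left_mono[OF _ \<open>0 \<le> L\<close>]] by blast
  qed
  \<comment> \<open>By \<open>orbit_near\<close> the ball of radius \<open>L * (D / 2)\<close> about
    \<open>T a z\<close> contains the whole orbit \<open>A\<close>, hence also \<open>z\<close> by
    the third property of the center.\<close>
  have self_near: "d (T a z) z \<le> L * (D / 2)" if "a \<in> carrier G" for a
    using TM[OF that z(1)] TM[OF _ x] orbit_near[OF that]
    by (intro z(3)) (auto simp: A_def simp del: times_divide_eq_right)
  show ?thesis
  proof
    show "z \<in> M" by fact
    have "T \<one>\<^bsub>G\<^esub> x \<in> A" by (simp add: A_def)
    then show "d x z \<le> D / 2" using z(2)[of x] T1[OF x] by simp
    fix a b assume ab: "a \<in> carrier G" "b \<in> carrier G"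
    then have "d z (T (inv\<^bsub>G\<^esub> a \<otimes>\<^bsub>G\<^esub> b) z) \<le> L * (D / 2)"
      using self_near[of "inv\<^bsub>G\<^esub> a \<otimes>\<^bsub>G\<^esub> b"] commute[of z] by auto
    then have "d (T a z) (T b z) \<le> L * (L * (D / 2))"
      using order_trans[OF Lip[OF ab z(1) z(1)] mult_left_mono[OF _ \<open>0 \<le> L\<close>]] by blast
    then show "d (T a z) (T b z) \<le> L\<^sup>2 / 2 * D"
      by (simp add: power2_eq_square mult.assoc)
  qed
qed

lemma common_fixed_point_exists:
  assumes hc: "hyperconvex" and "group G" and act: "acts_on G M T"
    and lip: "uniformly_lipschitzian G T L" and L: "0 < L" "L < sqrt 2"
    and p: "p \<in> M" and bdd: "mbounded (orbit G T p)"
  shows "common_fixed_points G M T \<noteq> {}"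
proof -
  interpret G: group G by fact
  have TM: "T a y \<in> M" if "a \<in> carrier G" "y \<in> M" for a y
    using act that unfolding acts_on_def by auto
  have T1: "T \<one>\<^bsub>G\<^esub> y = y" if "y \<in> M" for y
    using act that unfolding acts_on_def by auto
  obtain D where D: "\<And>a b. a \<in> carrier G \<Longrightarrow> b \<in> carrier G \<Longrightarrow> d (T a p) (T b p) \<le> D"
    using bdd unfolding mbounded_alt orbit_def by blast
  have D0: "0 \<le> D"
    using order_trans[OF nonneg D[OF G.one_closed G.one_closed]] .
  define k where "k = L\<^sup>2 / 2"
  \<comment> \<open>Here \<open>L < sqrt 2\<close> enters: it says exactly that the contraction
    factor is below 1.\<close>
  have k: "0 < k" "k < 1"
    using L real_less_rsqrt[of L 2] power_strict_mono[of L "sqrt 2" 2] by (auto simp: k_def)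
  define P where "P n y \<longleftrightarrow> y \<in> M \<and>
    (\<forall>a \<in> carrier G. \<forall>b \<in> carrier G. d (T a y) (T b y) \<le> D * k ^ n)" for n y
  \<comment> \<open>Dependent choice iterates \<open>orbit_contraction\<close>; the invariant
    \<open>P n\<close> bounds the orbit diameter by \<open>D * k ^ n\<close>, and each move is at
    most half of that bound.\<close>
  have "\<exists>x. \<forall>n. P n (x n) \<and> d (x n) (x (Suc n)) \<le> D * k ^ n / 2"
  proof (rule dependent_nat_choice)
    show "\<exists>y. P 0 y" using p D by (auto simp: P_def)
    fix y n assume "P n y"
    then have y: "y \<in> M"
      "\<And>a b. a \<in> carrier G \<Longrightarrow> b \<in> carrier G \<Longrightarrow> d (T a y) (T b y) \<le> D * k ^ n"
      by (auto simp: P_def)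
    obtain z where "z \<in> M" "d y z \<le> D * k ^ n / 2"
      "\<And>a b. a \<in> carrier G \<Longrightarrow> b \<in> carrier G \<Longrightarrow> d (T a z) (T b z) \<le> k * (D * k ^ n)"
      unfolding k_def
      by (rule orbit_contraction[OF hc \<open>group G\<close> act lip less_imp_le[OF L(1)] y])
        (simp_all add: k_def)
    then show "\<exists>z. P (Suc n) z \<and> d y z \<le> D * k ^ n / 2"
      by (auto simp: P_def mult.left_commute)
  qed
  then obtain x where x: "\<And>n. P n (x n)" "\<And>n. d (x n) (x (Suc n)) \<le> D * k ^ n / 2"
    by blast
  have xM: "x n \<in> M" for n using x(1) by (simp add: P_def)
  \<comment> \<open>\<open>e\<close> is the sum of all step bounds \<open>D * k ^ i / 2\<close>, and
    \<open>r n\<close> below is the tail of this geometric series from \<open>n\<close> on, so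
    consecutive radii differ by exactly one step bound.\<close>
  define e where "e = D / 2 * inverse (1 - k)"
  have e: "0 \<le> e" "e * (1 - k) = D / 2" using k D0 by (simp_all add: e_def mult.assoc)
  define r where "r n = e * k ^ n" for n
  obtain z where z: "z \<in> M" "\<And>n. d (x n) z \<le> r n"
  proof (rule hyperconvex_telescoping_limit[OF hc, of x r])
    fix n
    have "r n - r (Suc n) = e * (1 - k) * k ^ n"
      by (simp add: r_def algebra_simps)
    then show "d (x n) (x (Suc n)) \<le> r n - r (Suc n)"
      using x(2)[of n] e(2) by simp
  qed (use xM k e(1) in \<open>auto simp: r_def\<close>)
  have "T a z = z" if a: "a \<in> carrier G" for a
  proof -
    \<comment> \<open>The path runs from \<open>T a z\<close> through \<open>T a (x n)\<close> and
      \<open>x n\<close> to \<open>z\<close>. Its middle leg joins two points of the orbit of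
      \<open>x n\<close>, since \<open>x n\<close> is its own image under the identity.\<close>
    have bound: "d (T a z) z \<le> L * r n + D * k ^ n + r n" for n
    proof -
      have "d (T a z) (T a (x n)) \<le> L * r n"
      proof -
        have "d (T a z) (T a (x n)) \<le> L * d z (x n)"
          using lip a z(1) xM[of n] unfolding uniformly_lipschitzian_def by blast
        also have "\<dots> \<le> L * r n"
          using z(2)[of n] L(1) commute[of z "x n"] by simp
        finally show ?thesis .
      qed
      moreover have "d (T a (x n)) (x n) \<le> D * k ^ n"
        using x(1)[of n] a G.one_closed T1[of "x n"] unfolding P_def by metis
      ultimately show ?thesis
        using triangle[of "T a z" "T a (x n)" z] triangle[of "T a (x n)" "x n" z]
          TM[OF a z(1)] TM[OF a xM[of n]] xM[of n] z(1) z(2)[of n] by linarith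
    qed
    have "(\<lambda>n. L * r n + D * k ^ n + r n) \<longlonglongrightarrow> L * (e * 0) + D * 0 + e * 0"
      unfolding r_def using k by (intro tendsto_intros LIMSEQ_realpow_zero) auto
    then have "d (T a z) z \<le> 0"
      using bound by (intro LIMSEQ_le_const) auto
    then show ?thesis
      using TM[OF a z(1)] z(1) nonneg[of "T a z" z] zero[of "T a z" z] by linarith
  qed
  then show ?thesis
    using z(1) by (auto simp: common_fixed_points_def)
qed

end

theorem theorem2p3:
  fixes M :: "'a set" and d :: "'a \<Rightarrow> 'a \<Rightarrow> real"
    and G :: "('g, 'b) monoid_scheme" and T :: "'g \<Rightarrow> 'a \<Rightarrow> 'a" and L :: real
  assumes "Metric_space M d"
    and "M \<noteq> {}"
    and "Metric_space.hyperconvex M d"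
    and "group G"
    and "acts_on G M T"
    and "Metric_space.uniformly_lipschitzian M d G T L"
    and "0 < L" and "L < sqrt 2"
    and "\<And>x. x \<in> M \<Longrightarrow> Metric_space.mbounded M d (orbit G T x)"
  shows "common_fixed_points G M T \<noteq> {}"
  using assms Metric_space.common_fixed_point_exists[of M d G T L] by blast

end
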